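(* Let $S$ be a semigroup, let $x, y \in S$ with $y$ a stable element of $S$, and suppose that $x$ and $y$ belong to some subsemigroup $U$ of $S$ for which $\mathcal{L}' = \mathcal{L}{\restriction}_U$ and $\mathcal{R}' = \mathcal{R}{\restriction}_U$. If $x \mathrel{\mathcal{J}} y$ (in $S$) and $x \leq_{\mathcal{J}'} y$ (in $U$), then $x \mathrel{\mathcal{D}'} y$ (in $U$).
   Context: For a semigroup $T$, $T^1$ denotes $T$ if $T$ is a monoid, and otherwise $T$ with an identity adjoined. Green's pre-orders on $T$: $x \leq_{\mathcal{R}} y \iff x \in yT^1$; $x \leq_{\mathcal{L}} y \iff x \in T^1y$; $x \leq_{\mathcal{J}} y \iff x \in T^1yT^1$. Green's relations $\mathcal{R}, \mathcal{L}, \mathcal{J}$ are the equivalences induced by these pre-orders; $\mathcal{H} = \mathcal{R} \cap \mathcal{L}$; $\mathcal{D} = \mathcal{R} \circ \mathcal{L} = \mathcal{L} \circ \mathcal{R}$. If $U$ is a subsemigroup of $S$, unprimed symbols $\mathcal{G}$, $\leq_{\mathcal{G}}$ denote the relations on $S$, and primed symbols $\mathcal{G}'$, $\leq_{\mathcal{G}'}$ denote the corresponding relations on the semigroup $U$ (computed with multipliers in $U^1$). Also $\mathcal{G}{\restriction}_U = \mathcal{G} \cap (U \times U)$. An element $x$ of a semigroup $S$ is right-stable if for all $y \in S$, $x \mathrel{\mathcal{J}} xy \Rightarrow x \mathrel{\mathcal{R}} xy$; it is left-stable if for all $y \in S$, $x \mathrel{\mathcal{J}} yx \Rightarrow x \mathrel{\mathcal{L}}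 yx$; it is stable if it is both left- and right-stable. *)

theory Defs
  imports Main
begin

text \<open>The ambient semigroup is a type of class \<^class>\<open>semigroup_mult\<close>. The notions below take the
  semigroup they refer to as a carrier set \<open>T\<close>; they are meant for carriers closed under
  multiplication (\<open>UNIV\<close> for the ambient semigroup itself).\<close>

definition subsemigroup :: "'a::semigroup_mult set \<Rightarrow> bool" where
  "subsemigroup U \<longleftrightarrow> U \<noteq> {} \<and> (\<forall>a\<in>U. \<forall>b\<in>U. a * b \<in> U)"

definition has_identity :: "'a::semigroup_mult set \<Rightarrow> bool" where
  "has_identity T \<longleftrightarrow> (\<exists>e\<in>T. \<forall>t\<in>T. e * t = t \<and> t * e = t)"

text \<open>\<open>T\<^sup>1\<close> lives in the option type: \<open>Some t\<close> represents \<open>t \<in> T\<close>, and \<open>None\<close> is the adjoined identity,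
  present only if \<open>T\<close> is not already a monoid. The identity is relative to \<open>T\<close>: it need not be
  an identity of the ambient semigroup, nor conversely.\<close>

definition adjoin_one :: "'a::semigroup_mult set \<Rightarrow> 'a option set" where
  "adjoin_one T = (if has_identity T then Some ` T else insert None (Some ` T))"

fun mult_one ::
    "'a::semigroup_mult option \<Rightarrow> 'a option \<Rightarrow> 'a option" (infixl "\<cdot>\<^sub>1" 70) where
  "None \<cdot>\<^sub>1 b = b"
| "a \<cdot>\<^sub>1 None = a"
| "Some a \<cdot>\<^sub>1 Some b = Some (a * b)"

definition R_le :: "'a::semigroup_mult set \<Rightarrow> 'a rel" where
  "R_le T = {(x, y). x \<in> T \<and> y \<in> T \<and> (\<exists>t\<in>adjoin_one T. Some x = Some y \<cdot>\<^sub>1 t)}"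

definition L_le :: "'a::semigroup_mult set \<Rightarrow> 'a rel" where
  "L_le T = {(x, y). x \<in> T \<and> y \<in> T \<and> (\<exists>s\<in>adjoin_one T. Some x = s \<cdot>\<^sub>1 Some y)}"

definition J_le :: "'a::semigroup_mult set \<Rightarrow> 'a rel" where
  "J_le T = {(x, y). x \<in> T \<and> y \<in> T \<and>
     (\<exists>s\<in>adjoin_one T. \<exists>t\<in>adjoin_one T. Some x = s \<cdot>\<^sub>1 Some y \<cdot>\<^sub>1 t)}"

definition green_R :: "'a::semigroup_mult set \<Rightarrow> 'a rel" where
  "green_R T = R_le T \<inter> (R_le T)\<inverse>"

definition green_L :: "'a::semigroup_mult set \<Rightarrow> 'a rel" where
  "green_L T = L_le T \<inter> (L_le T)\<inverse>"

definition green_J :: "'a::semigroup_mult set \<Rightarrow> 'a rel" where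
  "green_J T = J_le T \<inter> (J_le T)\<inverse>"

text \<open>\<open>\<R>\<close> and \<open>\<L>\<close> commute, so the order of composition is immaterial.\<close>

definition green_D :: "'a::semigroup_mult set \<Rightarrow> 'a rel" where
  "green_D T = green_R T O green_L T"

definition right_stable :: "'a::semigroup_mult set \<Rightarrow> 'a \<Rightarrow> bool" where
  "right_stable T x \<longleftrightarrow> (\<forall>y\<in>T. (x, x * y) \<in> green_J T \<longrightarrow> (x, x * y) \<in> green_R T)"

definition left_stable :: "'a::semigroup_mult set \<Rightarrow> 'a \<Rightarrow> bool" where
  "left_stable T x \<longleftrightarrow> (\<forall>y\<in>T. (x, y * x) \<in> green_J T \<longrightarrow> (x, y * x) \<in> green_L T)"

definition stable_element :: "'a::semigroup_mult set \<Rightarrow> 'a \<Rightarrow> bool" where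
  "stable_element T x \<longleftrightarrow> right_stable T x \<and> left_stable T x"

end

theory Submission
  imports Defs
begin

text \<open>Write \<open>x = s y t\<close> with \<open>s\<close> and \<open>t\<close> in \<open>U\<^sup>1\<close>. In \<open>S\<close> the elements \<open>s y\<close> and \<open>y t\<close> both lie
  \<open>\<J>\<close>-between \<open>x\<close> and \<open>y\<close>, so \<open>x \<J> y\<close> makes both of them \<open>\<J>\<close>-equivalent to \<open>y\<close>. Stability of
  \<open>y\<close> turns this into \<open>y \<L> s y\<close> and \<open>y \<R> y t\<close>. As \<open>\<R>\<close> is a left congruence, the latter gives
  \<open>s y \<R> s y t = x\<close>. Now \<open>s y\<close> belongs to \<open>U\<close> because the multipliers were taken from \<open>U\<^sup>1\<close>, so
  both relations restrict to \<open>U\<close>, where they are \<open>\<R>'\<close> and \<open>\<L>'\<close> by hypothesis; hence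
  \<open>x \<R>' s y \<L>' y\<close>.

  The identity of \<open>U\<^sup>1\<close> and that of \<open>S\<^sup>1\<close> may differ, as each is adjoined only if needed. The
  lemmas on \<open>\<le>\<^sub>\<R>\<close>, \<open>\<le>\<^sub>\<L>\<close> and \<open>\<le>\<^sub>\<J>\<close> in \<open>S\<close> remove this difference: in \<open>S\<close> the adjoined identity
  can always be admitted as a multiplier, so that every multiplier from \<open>U\<^sup>1\<close> is one from \<open>S\<close>.\<close>

lemma mult_one_None_right [simp]: "a \<cdot>\<^sub>1 None = a"
  by (cases a) auto

lemma mult_one_assoc: "a \<cdot>\<^sub>1 b \<cdot>\<^sub>1 c = a \<cdot>\<^sub>1 (b \<cdot>\<^sub>1 c)"
  by (cases a; cases b; cases c) (auto simp: mult.assoc)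

lemma mult_one_Some_left: "\<exists>z. Some y \<cdot>\<^sub>1 t = Some z"
  by (cases t) auto

text \<open>If the ambient semigroup has an identity \<open>e\<close>, then \<open>Some e\<close> acts on every \<open>Some y\<close>
  as \<open>None\<close> does, so replacing \<open>None\<close> by \<open>Some e\<close> loses nothing.\<close>

lemma adjoin_one_UNIV_represents:
  "\<exists>t'\<in>adjoin_one UNIV. \<forall>y::'a::semigroup_mult.
    Some y \<cdot>\<^sub>1 t' = Some y \<cdot>\<^sub>1 t \<and> t' \<cdot>\<^sub>1 Some y = t \<cdot>\<^sub>1 Some y"
proof (cases "t \<in> adjoin_one UNIV")
  case True
  then show ?thesis by blast
next
  case False
  then have "t = None" and "has_identity (UNIV :: 'a set)"
    by (cases t; auto simp: adjoin_one_def split: if_splits)+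
  then obtain e :: 'a where "\<And>y. e * y = y" "\<And>y. y * e = y"
    by (auto simp: has_identity_def)
  with \<open>t = None\<close> \<open>has_identity (UNIV :: 'a set)\<close> show ?thesis
    by (intro bexI[of _ "Some e"]) (auto simp: adjoin_one_def)
qed

lemma R_le_UNIV_iff: "(x, y) \<in> R_le UNIV \<longleftrightarrow> (\<exists>t. Some x = Some y \<cdot>\<^sub>1 t)"
proof
  assume "\<exists>t. Some x = Some y \<cdot>\<^sub>1 t"
  then obtain t where x: "Some x = Some y \<cdot>\<^sub>1 t" by blast
  obtain t' where "t' \<in> adjoin_one UNIV" and "Some y \<cdot>\<^sub>1 t' = Some y \<cdot>\<^sub>1 t"
    using adjoin_one_UNIV_represents by blast
  with x show "(x, y) \<in> R_le UNIV"
    unfolding R_le_def by (auto intro: bexI[of _ t'])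
qed (auto simp: R_le_def)

lemma L_le_UNIV_iff: "(x, y) \<in> L_le UNIV \<longleftrightarrow> (\<exists>s. Some x = s \<cdot>\<^sub>1 Some y)"
proof
  assume "\<exists>s. Some x = s \<cdot>\<^sub>1 Some y"
  then obtain s where x: "Some x = s \<cdot>\<^sub>1 Some y" by blast
  obtain s' where "s' \<in> adjoin_one UNIV" and "s' \<cdot>\<^sub>1 Some y = s \<cdot>\<^sub>1 Some y"
    using adjoin_one_UNIV_represents by blast
  with x show "(x, y) \<in> L_le UNIV"
    unfolding L_le_def by (auto intro: bexI[of _ s'])
qed (auto simp: L_le_def)

lemma J_le_UNIV_iff: "(x, y) \<in> J_le UNIV \<longleftrightarrow> (\<exists>s t. Some x = s \<cdot>\<^sub>1 Some y \<cdot>\<^sub>1 t)"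
proof
  assume "\<exists>s t. Some x = s \<cdot>\<^sub>1 Some y \<cdot>\<^sub>1 t"
  then obtain s t where x: "Some x = s \<cdot>\<^sub>1 Some y \<cdot>\<^sub>1 t" by blast
  obtain s' where s': "s' \<in> adjoin_one UNIV" "s' \<cdot>\<^sub>1 Some y = s \<cdot>\<^sub>1 Some y"
    using adjoin_one_UNIV_represents by blast
  obtain z where z: "s \<cdot>\<^sub>1 Some y = Some z"
    by (cases s) auto
  obtain t' where t': "t' \<in> adjoin_one UNIV" "Some z \<cdot>\<^sub>1 t' = Some z \<cdot>\<^sub>1 t"
    using adjoin_one_UNIV_represents by blast
  have "Some x = s' \<cdot>\<^sub>1 Some y \<cdot>\<^sub>1 t'"
    using x s'(2) t'(2) z by simp
  with s'(1) t'(1) show "(x, y) \<in> J_le UNIV"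
    unfolding J_le_def by blast
qed (auto simp: J_le_def)

lemma J_le_UNIV_trans:
  assumes "(x, y) \<in> J_le UNIV" and "(y, z) \<in> J_le UNIV"
  shows "(x, z) \<in> J_le UNIV"
proof -
  obtain s t where "Some x = s \<cdot>\<^sub>1 Some y \<cdot>\<^sub>1 t"
    using assms(1) unfolding J_le_UNIV_iff by blast
  moreover obtain s' t' where "Some y = s' \<cdot>\<^sub>1 Some z \<cdot>\<^sub>1 t'"
    using assms(2) unfolding J_le_UNIV_iff by blast
  ultimately have "Some x = (s \<cdot>\<^sub>1 s') \<cdot>\<^sub>1 Some z \<cdot>\<^sub>1 (t' \<cdot>\<^sub>1 t)"
    by (simp add: mult_one_assoc)
  then show ?thesis unfolding J_le_UNIV_iff by blast
qed

text \<open>Stability stays true when the multiplier is the adjoined identity, since then nothing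
  moves.\<close>

lemma right_stable_mult_one:
  assumes "right_stable UNIV y" and "Some w = Some y \<cdot>\<^sub>1 t" and "(y, w) \<in> green_J UNIV"
  shows "(y, w) \<in> green_R UNIV"
proof (cases t)
  case None
  then have "w = y" using assms(2) by simp
  then show ?thesis
    by (auto simp: green_R_def R_le_UNIV_iff intro: exI[of _ None])
next
  case (Some u)
  then show ?thesis using assms by (auto simp: right_stable_def)
qed

lemma left_stable_mult_one:
  assumes "left_stable UNIV y" and "Some z = s \<cdot>\<^sub>1 Some y" and "(y, z) \<in> green_J UNIV"
  shows "(y, z) \<in> green_L UNIV"
proof (cases s)
  case None
  then have "z = y" using assms(2) by simp
  then show ?thesis
    by (auto simp: green_L_def L_le_UNIV_iff intro: exI[of _ None])
next
  case (Some u)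
  then show ?thesis using assms by (auto simp: left_stable_def)
qed

lemma green_R_left_congruence:
  assumes "(a, b) \<in> green_R UNIV" and a': "Some a' = s \<cdot>\<^sub>1 Some a" and b': "Some b' = s \<cdot>\<^sub>1 Some b"
  shows "(a', b') \<in> green_R UNIV"
proof -
  obtain t u where t: "Some a = Some b \<cdot>\<^sub>1 t" and u: "Some b = Some a \<cdot>\<^sub>1 u"
    using assms(1) unfolding green_R_def Int_iff converse_iff R_le_UNIV_iff by blast
  have "Some a' = Some b' \<cdot>\<^sub>1 t"
    unfolding a' b' mult_one_assoc by (simp only: t)
  moreover have "Some b' = Some a' \<cdot>\<^sub>1 u"
    unfolding a' b' mult_one_assoc by (simp only: u)
  ultimately show ?thesis
    unfolding green_R_def Int_iff converse_iff R_le_UNIV_iff by blast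
qed

lemma subsemigroup_adjoin_one_mult:
  assumes "subsemigroup U" and "y \<in> U" and "s \<in> adjoin_one U"
  shows "\<exists>z\<in>U. Some z = s \<cdot>\<^sub>1 Some y"
  using assms by (cases s) (auto simp: subsemigroup_def adjoin_one_def split: if_splits)

theorem theorem8:
  fixes x y :: "'a::semigroup_mult" and U :: "'a set"
  assumes "stable_element UNIV y"
    and "subsemigroup U" and "x \<in> U" and "y \<in> U"
    and "green_L U = green_L UNIV \<inter> (U \<times> U)"
    and "green_R U = green_R UNIV \<inter> (U \<times> U)"
    and "(x, y) \<in> green_J UNIV"
    and "(x, y) \<in> J_le U"
  shows "(x, y) \<in> green_D U"
proof -
  obtain s t where s: "s \<in> adjoin_one U" and x: "Some x = s \<cdot>\<^sub>1 Some y \<cdot>\<^sub>1 t"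
    using assms(8) by (auto simp: J_le_def)
  obtain z where "z \<in> U" and z: "Some z = s \<cdot>\<^sub>1 Some y"
    using subsemigroup_adjoin_one_mult assms(2,4) s by blast
  obtain w where w: "Some w = Some y \<cdot>\<^sub>1 t"
    using mult_one_Some_left by metis
  have x_z: "Some x = None \<cdot>\<^sub>1 Some z \<cdot>\<^sub>1 t" and x_w: "Some x = s \<cdot>\<^sub>1 Some w"
    by (simp_all add: x z w mult_one_assoc)

  have y_x: "(y, x) \<in> J_le UNIV"
    using assms(7) by (simp add: green_J_def)
  have "(x, z) \<in> J_le UNIV" and "(z, y) \<in> J_le UNIV"
    and "(x, w) \<in> J_le UNIV" and "(w, y) \<in> J_le UNIV"
    unfolding J_le_UNIV_iff
    using x_z z x_w w mult_one_None_right mult_one.simps(1) by metis+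
  with y_x have "(y, z) \<in> green_J UNIV" and "(y, w) \<in> green_J UNIV"
    using J_le_UNIV_trans[of y x] by (simp_all add: green_J_def)
  then have "(y, z) \<in> green_L UNIV" and "(y, w) \<in> green_R UNIV"
    using assms(1) left_stable_mult_one[OF _ z] right_stable_mult_one[OF _ w]
    unfolding stable_element_def by blast+
  moreover from \<open>(y, w) \<in> green_R UNIV\<close> have "(z, x) \<in> green_R UNIV"
    using z x_w by (rule green_R_left_congruence)
  ultimately have "(x, z) \<in> green_R UNIV" and "(z, y) \<in> green_L UNIV"
    by (simp_all add: green_R_def green_L_def)
  then have "(x, z) \<in> green_R U" and "(z, y) \<in> green_L U"
    using assms(3-6) \<open>z \<in> U\<close> by simp_all
  then show ?thesis by (auto simp: green_D_def)
qed

end
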